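(* Let $m<n$, let $a_1,\dots,a_m\in\mathbb{Q}^n$, let $q$ be the least positive integer with $qa_1,\dots,qa_m\in\mathbb{Z}^n$, and assume $q$ is square-free, $q=p_1p_2\cdots p_s$ with distinct primes $p_1>p_2>\dots>p_s$. Let $A$ be the $m\times n$ integer matrix whose rows are $qa_1,\dots,qa_m$, and for each $j$ let $\mathrm{rank}_j$ be the rank of $A$ over the field $\mathbb{Z}_{p_j}$. For each $j$ let $\mathcal{M}_j$ be the family of all $\mathrm{rank}_j$-element subsets $S\subseteq\{1,\dots,n\}$ such that the columns of $A$ with indices in $S$ are linearly independent over $\mathbb{Z}_{p_j}$. Let $M\subseteq\{1,\dots,n\}$ be any set such that for every $j\in\{1,\dots,s\}$ some member of $\mathcal{M}_j$ is contained in $M$. Then, with $\Lambda=\langle\mathbb{Z}^n,a_1,\dots,a_m\rangle_{\mathbb{Z}}$, we have $d(\mathcal{E},\Lambda)\le|M|$.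
   Context: $\mathcal{E}=\{e_1,\dots,e_n\}$ is the standard basis of $\mathbb{Z}^n$. For a lattice $\Lambda$ with $\mathbb{Z}^n\subseteq\Lambda\subset\mathbb{Q}^n$, the defect $d(\mathcal{E},\Lambda)$ is the smallest integer $d$ such that some $n-d$ vectors of $\mathcal{E}$ together with some $d$ vectors of $\Lambda$ form a basis of $\Lambda$. $\mathbb{Z}_p$ denotes the field with $p$ elements. *)

theory Defs
  imports
    "HOL-Analysis.Analysis"
    "HOL-Computational_Algebra.Computational_Algebra"
    "HOL-Number_Theory.Cong"
begin

definition int_scale :: "int \<Rightarrow> rat ^ 'n \<Rightarrow> rat ^ 'n" where
  "int_scale k v = of_int k *s v"

interpretation int_module: module int_scale
  by standard (simp_all add: int_scale_def vec_eq_iff algebra_simps)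

definition integer_vectors :: "(rat ^ 'n) set" where
  "integer_vectors = {v. \<forall>k. v $ k \<in> \<int>}"

definition is_lattice_basis :: "(rat ^ 'n) set \<Rightarrow> (rat ^ 'n) set \<Rightarrow> bool" where
  "is_lattice_basis B L \<longleftrightarrow> int_module.independent B \<and> int_module.span B = L"

text \<open>The minimum exists whenever \<open>E\<close> is the standard basis and \<open>L\<close> is a lattice of
  full rank, as \<open>d = CARD('n)\<close> is then admissible. The conjunct \<open>d \<le> CARD('n)\<close> keeps the
  subtraction on \<^typ>\<open>nat\<close> from truncating.\<close>

definition defect :: "(rat ^ 'n) set \<Rightarrow> (rat ^ 'n) set \<Rightarrow> nat" where
  "defect E L = (LEAST d. d \<le> CARD('n) \<and>
     (\<exists>F G. F \<subseteq> E \<and> finite F \<and> card F = CARD('n) - d \<and>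
            G \<subseteq> L \<and> finite G \<and> card G = d \<and>
            F \<inter> G = {} \<and> is_lattice_basis (F \<union> G) L))"

text \<open>An \<open>m \<times> n\<close> integer matrix is given by its rows \<open>A 1, \<dots>, A m\<close>. Since the prime \<open>p\<close> is
  a term, the field with \<open>p\<close> elements is not available as a type; its elements are represented
  by integers and equality in it is congruence modulo \<open>p\<close>.\<close>

definition columns_indep_mod :: "nat \<Rightarrow> nat \<Rightarrow> (nat \<Rightarrow> int ^ 'n) \<Rightarrow> 'n set \<Rightarrow> bool" where
  "columns_indep_mod p m A S \<longleftrightarrow>
     (\<forall>c :: 'n \<Rightarrow> int.
        (\<forall>i\<in>{1..m}. [(\<Sum>k\<in>S. c k * A i $ k) = 0] (mod int p)) \<longrightarrow>
        (\<forall>k\<in>S. [c k = 0] (mod int p)))"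

definition rank_mod :: "nat \<Rightarrow> nat \<Rightarrow> (nat \<Rightarrow> int ^ 'n) \<Rightarrow> nat" where
  "rank_mod p m A = Max {card S | S. columns_indep_mod p m A S}"

definition column_bases_mod :: "nat \<Rightarrow> nat \<Rightarrow> (nat \<Rightarrow> int ^ 'n) \<Rightarrow> 'n set set" where
  "column_bases_mod p m A = {S. card S = rank_mod p m A \<and> columns_indep_mod p m A S}"

end

theory Submission
  imports Defs
begin

text \<open>
  A vector \<open>v\<close> of \<open>\<Lambda>\<close> that vanishes on the coordinates in \<open>M\<close> is integral: \<open>q v\<close> is congruent
  modulo \<open>q\<close> to an integer combination of the rows of \<open>A\<close>. Modulo each \<open>p\<^sub>j\<close> every column of
  \<open>A\<close> depends on the columns in \<open>M\<close>, so this combination vanishes modulo \<open>p\<^sub>j\<close>, hence modulo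
  \<open>q\<close>. So the unit vectors outside \<open>M\<close> form a basis of the sublattice of \<open>\<Lambda>\<close> where the
  coordinates in \<open>M\<close> vanish. Releasing these coordinates one at a time enlarges the basis by one
  vector per step, namely one whose new coordinate is positive and minimal.
\<close>

text \<open>The values \<open>v $ k\<close> on \<open>H\<close> form a subgroup of (1/q)Z, which
  \<open>w\<close> makes nonzero, so it is infinite cyclic. A vector \<open>v\<close> whose value
  generates this group splits \<open>H\<close> as the direct sum of Z \<open>v\<close> and the
  kernel of the coordinate, for which \<open>B\<close> is a basis.\<close>

lemma lattice_basis_insert:
  fixes H :: "(rat ^ 'n) set" and w :: "rat ^ 'n"
  assumes H: "int_module.subspace H"
    and B: "is_lattice_basis B {v \<in> H. v $ k = 0}"
    and q: "0 < (q::nat)" "\<And>v. v \<in> H \<Longrightarrow> of_nat q * v $ k \<in> \<int>"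
    and w: "w \<in> H" "w $ k \<noteq> 0"
  obtains v where "v \<in> H" "v \<notin> B" "is_lattice_basis (insert v B) H"
proof -
  \<comment> \<open>Multiplying by \<open>q\<close> turns the coordinate values into integers, so a
    least positive one exists by well-ordering of the naturals.\<close>
  define P where "P n \<longleftrightarrow> 0 < n \<and> (\<exists>v\<in>H. of_nat q * v $ k = of_nat n)" for n :: nat
  have ex: "\<exists>n. P n"
  proof -
    obtain z where z: "of_nat q * w $ k = of_int z"
      using q(2)[OF w(1)] by (auto elim: Ints_cases)
    have "z \<noteq> 0" using z w q by auto
    moreover have "int_scale (sgn z) w \<in> H"
      using H w by (simp add: int_module.subspace_def)
    moreover have "of_nat q * int_scale (sgn z) w $ k = of_nat (nat \<bar>z\<bar>)"
      using z by (simp add: int_scale_def sgn_if)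
    ultimately show ?thesis
      unfolding P_def by (intro exI[of _ "nat \<bar>z\<bar>"]) auto
  qed
  define n where "n = (LEAST n. P n)"
  have "P n" unfolding n_def using ex by (rule LeastI_ex)
  then obtain v where n: "0 < n" and v: "v \<in> H" "of_nat q * v $ k = of_nat n"
    unfolding P_def by blast
  have vk: "v $ k \<noteq> 0" using v(2) n by auto
  \<comment> \<open>Division with remainder: subtracting \<open>z div int n\<close> copies of
    \<open>v\<close> leaves \<open>z mod int n\<close> as the scaled coordinate. It is below
    \<open>n\<close>, so minimality of \<open>n\<close> forces it to be zero.\<close>
  have dec: "\<exists>t. u - int_scale t v \<in> {v \<in> H. v $ k = 0}" if u: "u \<in> H" for u
  proof -
    obtain z where z: "of_nat q * u $ k = of_int z"
      using q(2)[OF u] by (auto elim: Ints_cases)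
    define r where "r = u - int_scale (z div int n) v"
    have r: "r \<in> H"
      using H u v(1) by (simp add: r_def int_module.subspace_diff int_module.subspace_scale)
    have "of_nat q * r $ k = of_int z - of_int (z div int n) * of_nat n"
      using z v(2) by (simp add: r_def int_scale_def algebra_simps)
    also have "\<dots> = of_int (z - z div int n * int n)" by simp
    also have "\<dots> = of_int (z mod int n)" by (simp only: minus_div_mult_eq_mod)
    also have "\<dots> = of_nat (nat (z mod int n))" using n by simp
    finally have rk: "of_nat q * r $ k = of_nat (nat (z mod int n))" .
    have "nat (z mod int n) < n" using n by (simp add: nat_less_iff)
    then have "\<not> P (nat (z mod int n))" unfolding n_def by (rule not_less_Least)
    then have "nat (z mod int n) = 0" using r rk unfolding P_def by (metis gr0I)
    then have "r $ k = 0" using rk q(1) by simp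
    then show ?thesis using r unfolding r_def by blast
  qed
  have Bs: "int_module.span B = {v \<in> H. v $ k = 0}" and Bi: "int_module.independent B"
    using B by (auto simp: is_lattice_basis_def)
  have Bk: "b \<in> H \<and> b $ k = 0" if "b \<in> B" for b
    using int_module.span_base[OF that] unfolding Bs by simp
  have "int_module.span (insert v B) = H"
  proof
    show "int_module.span (insert v B) \<subseteq> H"
      using Bk v(1) H by (intro int_module.span_minimal) auto
    show "H \<subseteq> int_module.span (insert v B)"
      using dec Bs by (auto simp: int_module.span_breakdown_eq)
  qed
  moreover have "int_module.independent (insert v B)"
    unfolding int_module.dependent_explicit
  proof clarify
    fix t f u
    assume t: "finite t" "t \<subseteq> insert v B" "(\<Sum>x\<in>t. int_scale (f x) x) = 0" "u \<in> t" "f u \<noteq> 0"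
    \<comment> \<open>In coordinate \<open>k\<close> of a linear relation only \<open>v\<close> can
      contribute. Its coefficient is therefore zero, and the relation is already one within
      \<open>B\<close>.\<close>
    have "(\<Sum>x\<in>t. of_int (f x) * x $ k) = 0"
      using arg_cong[OF t(3), of "\<lambda>x. x $ k"] by (simp add: int_scale_def)
    moreover have "(\<Sum>x\<in>t. of_int (f x) * x $ k) = (\<Sum>x\<in>t \<inter> {v}. of_int (f x) * x $ k)"
      using t(1,2) Bk by (intro sum.mono_neutral_right) auto
    ultimately have fv: "v \<notin> t \<or> f v = 0" using vk by (cases "v \<in> t") auto
    have "(\<Sum>x\<in>t - {v}. int_scale (f x) x) = (\<Sum>x\<in>t. int_scale (f x) x)"
      using t(1) fv by (intro sum.mono_neutral_left) (auto simp: int_scale_def)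
    then have "int_module.dependent B"
      unfolding int_module.dependent_explicit using t fv
      by (intro exI[of _ "t - {v}"] exI[of _ f]) auto
    then show False using Bi by simp
  qed
  moreover have "v \<notin> B" using Bk vk by blast
  ultimately show ?thesis using that v(1) by (simp add: is_lattice_basis_def)
qed

lemma unit_vectors_lattice_basis:
  "is_lattice_basis ((\<lambda>k. axis k 1) ` K) {v :: rat ^ 'n. v \<in> integer_vectors \<and> (\<forall>k. k \<notin> K \<longrightarrow> v $ k = 0)}"
proof -
  let ?e = "\<lambda>k. axis k 1 :: rat ^ 'n"
  let ?I = "{v. v \<in> integer_vectors \<and> (\<forall>k. k \<notin> K \<longrightarrow> v $ k = 0)} :: (rat ^ 'n) set"
  have sub: "int_module.subspace ?I"
    by (auto simp: int_module.subspace_def integer_vectors_def int_scale_def)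
  have "int_module.span (?e ` K) = ?I"
  proof
    show "int_module.span (?e ` K) \<subseteq> ?I"
      using sub by (intro int_module.span_minimal) (auto simp: integer_vectors_def axis_def)
    show "?I \<subseteq> int_module.span (?e ` K)"
    proof
      fix v assume v: "v \<in> ?I"
      then have "\<forall>k. \<exists>z. v $ k = of_int z"
        by (auto simp: integer_vectors_def Ints_def)
      then obtain z where z: "\<And>k. v $ k = of_int (z k)" by metis
      have z0: "z k = 0" if "k \<notin> K" for k
        using v that z[of k] by auto
      have "v = (\<Sum>k\<in>K. int_scale (z k) (?e k))"
        using z z0 by (auto simp: vec_eq_iff int_scale_def axis_def if_distrib cong: if_cong)
      also have "\<dots> \<in> int_module.span (?e ` K)"
        by (intro int_module.span_sum int_module.span_scale int_module.span_base imageI)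
      finally show "v \<in> int_module.span (?e ` K)" .
    qed
  qed
  moreover have "int_module.independent (?e ` K)"
    unfolding int_module.dependent_explicit
  proof clarify
    fix t f u
    assume t: "finite t" "t \<subseteq> ?e ` K" "(\<Sum>x\<in>t. int_scale (f x) x) = 0" "u \<in> t" "f u \<noteq> 0"
    then obtain k where u: "u = ?e k" by blast
    \<comment> \<open>Coordinate \<open>k\<close>, the one where \<open>u\<close> has its entry 1,
      isolates the coefficient \<open>f u\<close>.\<close>
    have "(\<Sum>x\<in>t. of_int (f x) * x $ k) = 0"
      using arg_cong[OF t(3), of "\<lambda>x. x $ k"] by (simp add: int_scale_def)
    moreover have "of_int (f x) * x $ k = 0" if x: "x \<in> t - {u}" for x
    proof -
      obtain l where "x = ?e l" using x t(2) by blast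
      then show ?thesis using x u by (auto simp: axis_def)
    qed
    then have "(\<Sum>x\<in>t. of_int (f x) * x $ k) = (\<Sum>x\<in>{u}. of_int (f x) * x $ k)"
      using t(1,4) by (intro sum.mono_neutral_right ballI) blast+
    moreover have "u $ k = 1" by (simp add: u)
    ultimately show False using t(5) by simp
  qed
  ultimately show ?thesis by (simp add: is_lattice_basis_def)
qed

text \<open>Induction over the set \<open>T\<close> of released coordinates, with one application of
  \<open>lattice_basis_insert\<close> per element; at \<open>T = M\<close> no constraint is left.
  Disjointness of \<open>B\<close> and \<open>G\<close> is carried along so that the new vectors can
  be counted.\<close>

lemma lattice_basis_extend:
  fixes L :: "(rat ^ 'n) set"
  assumes L: "int_module.subspace L" "integer_vectors \<subseteq> L"
    and q: "0 < (q::nat)" "\<And>v. v \<in> L \<Longrightarrow> of_nat q *s v \<in> integer_vectors"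
    and B: "is_lattice_basis B {v \<in> L. \<forall>k\<in>M. v $ k = 0}"
  obtains G where "G \<subseteq> L" "finite G" "card G = card M" "B \<inter> G = {}" "is_lattice_basis (B \<union> G) L"
proof -
  have "\<exists>G. G \<subseteq> L \<and> finite G \<and> card G = card T \<and> B \<inter> G = {} \<and>
      is_lattice_basis (B \<union> G) {v \<in> L. \<forall>k\<in>M - T. v $ k = 0}" if "finite T" "T \<subseteq> M" for T
    using that
  proof (induction T)
    case empty
    then show ?case using B by (intro exI[of _ "{}"]) auto
  next
    case (insert k T)
    then obtain G where G: "G \<subseteq> L" "finite G" "card G = card T" "B \<inter> G = {}"
      "is_lattice_basis (B \<union> G) {v \<in> L. \<forall>k\<in>M - T. v $ k = 0}" by auto
    let ?H = "{v \<in> L. \<forall>l\<in>M - insert k T. v $ l = 0}"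
    have H: "int_module.subspace ?H"
      using L(1) by (auto simp: int_module.subspace_def int_scale_def)
    have "{v \<in> L. \<forall>k\<in>M - T. v $ k = 0} = {v \<in> ?H. v $ k = 0}"
      using insert.prems insert.hyps by auto
    then have BG: "is_lattice_basis (B \<union> G) {v \<in> ?H. v $ k = 0}"
      using G(5) by (simp only:)
    have qk: "of_nat q * v $ k \<in> \<int>" if "v \<in> ?H" for v
      using q(2)[of v] that by (auto simp: integer_vectors_def)
    \<comment> \<open>The unit vector shows that the coordinate being released is not identically
      zero on \<open>?H\<close>.\<close>
    have e: "axis k 1 \<in> ?H" "axis k 1 $ k \<noteq> (0 :: rat)"
      using L(2) by (auto simp: axis_def integer_vectors_def)
    obtain v where v: "v \<in> ?H" "v \<notin> B \<union> G" "is_lattice_basis (insert v (B \<union> G)) ?H"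
      by (rule lattice_basis_insert[OF H BG q(1) qk e])
    show ?case
      using v G insert.hyps by (intro exI[of _ "insert v G"]) auto
  qed
  from this[of M] show ?thesis using that by auto
qed

text \<open>A set of independent columns of maximal size spans the column space mod
  \<open>p\<close>. So column \<open>k\<close> is a combination of the columns in \<open>S\<close>,
  and a combination of rows that vanishes on \<open>S\<close> must vanish at \<open>k\<close>
  too.\<close>

lemma column_basis_dvd:
  fixes A :: "nat \<Rightarrow> int ^ 'n"
  assumes p: "prime p" and S: "S \<in> column_bases_mod p m A"
    and d: "\<And>k. k \<in> S \<Longrightarrow> int p dvd (\<Sum>i=1..m. d i * A i $ k)"
  shows "int p dvd (\<Sum>i=1..m. d i * A i $ k)"
proof (cases "k \<in> S")
  case False
  have S': "card S = rank_mod p m A" "columns_indep_mod p m A S"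
    using S by (auto simp: column_bases_mod_def)
  have "\<not> columns_indep_mod p m A (insert k S)"
  proof
    assume "columns_indep_mod p m A (insert k S)"
    then have "card (insert k S) \<le> rank_mod p m A"
      unfolding rank_mod_def by (intro Max_ge) auto
    then show False using S'(1) False by simp
  qed
  then obtain c where c: "\<And>i. i \<in> {1..m} \<Longrightarrow> int p dvd (\<Sum>l\<in>insert k S. c l * A i $ l)"
    and c': "\<exists>l\<in>insert k S. \<not> int p dvd c l"
    unfolding columns_indep_mod_def cong_0_iff by blast
  \<comment> \<open>Otherwise the relation mod \<open>p\<close> would involve only the columns in
    \<open>S\<close>, whose independence makes it trivial.\<close>
  have ck: "\<not> int p dvd c k"
  proof
    assume dv: "int p dvd c k"
    have "int p dvd (\<Sum>l\<in>S. c l * A i $ l)" if "i \<in> {1..m}" for i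
      using c[OF that] dv False by (simp add: dvd_add_right_iff)
    then have "\<forall>l\<in>S. int p dvd c l"
      using S'(2) unfolding columns_indep_mod_def by (auto simp: cong_0_iff)
    then show False using c' dv by auto
  qed
  \<comment> \<open>The double sum is read in two ways. Row by row, each inner sum is divisible by
    \<open>p\<close>; column by column, every term with \<open>l\<close> in \<open>S\<close> is
    divisible, which leaves the term of \<open>k\<close>.\<close>
  have "int p dvd (\<Sum>i=1..m. d i * (\<Sum>l\<in>insert k S. c l * A i $ l))"
    by (rule dvd_sum, rule dvd_mult, rule c)
  also have "(\<Sum>i=1..m. d i * (\<Sum>l\<in>insert k S. c l * A i $ l))
      = (\<Sum>l\<in>insert k S. c l * (\<Sum>i=1..m. d i * A i $ l))"
    unfolding sum_distrib_left by (subst sum.swap) (simp add: algebra_simps)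
  also have "\<dots> = c k * (\<Sum>i=1..m. d i * A i $ k) + (\<Sum>l\<in>S. c l * (\<Sum>i=1..m. d i * A i $ l))"
    using False by simp
  finally have "int p dvd c k * (\<Sum>i=1..m. d i * A i $ k)"
    using d by (subst (asm) dvd_add_left_iff) (auto intro!: dvd_sum)
  then show ?thesis using ck p by (simp add: prime_dvd_mult_iff)
qed (use d in auto)

text \<open>The vectors that admit such coefficients form a submodule containing all the generators.
  This supplies explicit coefficients on the \<open>a i\<close> for each vector of the
  lattice.\<close>

lemma span_integer_vectors_Un:
  fixes a :: "nat \<Rightarrow> rat ^ 'n"
  assumes "v \<in> int_module.span (integer_vectors \<union> a ` I)" "finite I"
  obtains c where "v - (\<Sum>i\<in>I. int_scale (c i) (a i)) \<in> integer_vectors"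
proof -
  let ?W = "{v. \<exists>c. v - (\<Sum>i\<in>I. int_scale (c i) (a i)) \<in> integer_vectors}"
  have "int_module.subspace ?W"
  proof (rule int_module.subspaceI)
    show "0 \<in> ?W"
      by (auto intro!: exI[of _ "\<lambda>_. 0"] simp: integer_vectors_def int_scale_def)
    fix x y assume "x \<in> ?W" "y \<in> ?W"
    then obtain c d where "x - (\<Sum>i\<in>I. int_scale (c i) (a i)) \<in> integer_vectors"
      "y - (\<Sum>i\<in>I. int_scale (d i) (a i)) \<in> integer_vectors" by auto
    then have "(x - (\<Sum>i\<in>I. int_scale (c i) (a i))) + (y - (\<Sum>i\<in>I. int_scale (d i) (a i))) \<in> integer_vectors"
      by (auto simp: integer_vectors_def simp del: sum_component)
    then show "x + y \<in> ?W"
      by (auto intro!: exI[of _ "\<lambda>i. c i + d i"]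
          simp: int_module.scale_left_distrib sum.distrib add_diff_add)
  next
    fix z x assume "x \<in> ?W"
    then obtain c where "x - (\<Sum>i\<in>I. int_scale (c i) (a i)) \<in> integer_vectors" by auto
    then have "int_scale z (x - (\<Sum>i\<in>I. int_scale (c i) (a i))) \<in> integer_vectors"
      by (auto simp: integer_vectors_def int_scale_def simp del: sum_component vector_minus_component
          vector_ssub_ldistrib)
    then show "int_scale z x \<in> ?W"
      by (auto intro!: exI[of _ "\<lambda>i. z * c i"]
          simp: int_module.scale_right_diff_distrib int_module.scale_sum_right)
  qed
  moreover have "integer_vectors \<union> a ` I \<subseteq> ?W"
  proof safe
    fix x :: "rat ^ 'n" assume "x \<in> integer_vectors"
    then show "\<exists>c. x - (\<Sum>i\<in>I. int_scale (c i) (a i)) \<in> integer_vectors"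
      by (intro exI[of _ "\<lambda>_. 0"]) simp
  next
    fix i assume "i \<in> I"
    then have "(\<Sum>j\<in>I. int_scale (if j = i then 1 else 0) (a j)) = a i"
      using assms(2) by (simp add: if_distrib[of "\<lambda>c. int_scale c _"] cong: if_cong)
    then show "\<exists>c. a i - (\<Sum>i\<in>I. int_scale (c i) (a i)) \<in> integer_vectors"
      by (intro exI[of _ "\<lambda>j. if j = i then 1 else 0"]) (simp add: integer_vectors_def)
  qed
  ultimately have "int_module.span (integer_vectors \<union> a ` I) \<subseteq> ?W"
    by (intro int_module.span_minimal)
  then show ?thesis using assms(1) that by auto
qed

theorem theorem4:
  fixes m q s :: nat
    and a :: "nat \<Rightarrow> rat ^ 'n"
    and p :: "nat \<Rightarrow> nat"
    and A :: "nat \<Rightarrow> int ^ 'n"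
    and M :: "'n set"
    and \<Lambda> :: "(rat ^ 'n) set"
  assumes "m < CARD('n)"
    and "q = (LEAST k :: nat. 0 < k \<and> (\<forall>i\<in>{1..m}. of_nat k *s a i \<in> integer_vectors))"
    and "squarefree q"
    and "q = (\<Prod>j=1..s. p j)"
    and "\<forall>j\<in>{1..s}. prime (p j)"
    and "\<forall>j\<in>{1..s}. \<forall>l\<in>{1..s}. j < l \<longrightarrow> p l < p j"
    and "\<forall>i\<in>{1..m}. \<forall>k. of_int (A i $ k) = (of_nat q *s a i) $ k"
    and "\<forall>j\<in>{1..s}. \<exists>S\<in>column_bases_mod (p j) m A. S \<subseteq> M"
    and "\<Lambda> = int_module.span (integer_vectors \<union> a ` {1..m})"
  shows "defect cart_basis \<Lambda> \<le> card M"
proof -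
  \<comment> \<open>Zero is not square-free.\<close>
  have q: "0 < q" using assms(3) by (cases "q = 0") auto
  have sub: "int_module.subspace \<Lambda>" and Z: "integer_vectors \<subseteq> \<Lambda>"
    using assms(9) int_module.span_superset[of "integer_vectors \<union> a ` {1..m}"] by auto
  \<comment> \<open>Scaling by \<open>q\<close> replaces each \<open>a i\<close> by the integer row
    \<open>A i\<close>, so \<open>q v\<close> is a combination of rows up to a multiple of
    \<open>q\<close>.\<close>
  have repr: "\<exists>c z. \<forall>k. of_nat q * v $ k = of_int (int q * z k + (\<Sum>i=1..m. c i * A i $ k))"
    if v: "v \<in> \<Lambda>" for v
  proof -
    obtain c where c: "v - (\<Sum>i=1..m. int_scale (c i) (a i)) \<in> integer_vectors"
      using span_integer_vectors_Un[of v a "{1..m}"] v assms(9) by blast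
    then have "\<forall>k. \<exists>z. v $ k - (\<Sum>i=1..m. of_int (c i) * a i $ k) = of_int z"
      by (auto simp: integer_vectors_def int_scale_def Ints_def)
    then obtain z where z: "\<And>k. v $ k - (\<Sum>i=1..m. of_int (c i) * a i $ k) = of_int (z k)"
      by metis
    have "of_nat q * v $ k = of_int (int q * z k + (\<Sum>i=1..m. c i * A i $ k))" for k
    proof -
      have "v $ k = of_int (z k) + (\<Sum>i=1..m. of_int (c i) * a i $ k)"
        using z[of k] by (simp add: algebra_simps)
      then show ?thesis using assms(7)
        by (simp add: distrib_left sum_distrib_left mult.left_commute)
    qed
    then show ?thesis by blast
  qed
  have qL: "of_nat q *s v \<in> integer_vectors" if "v \<in> \<Lambda>" for v
    using repr[OF that] by (auto simp: integer_vectors_def simp del: of_int_add of_int_sum of_int_mult)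
  have prim: "v \<in> integer_vectors" if v: "v \<in> \<Lambda>" "\<forall>k\<in>M. v $ k = 0" for v
  proof -
    obtain c z where cz: "\<And>k. of_nat q * v $ k = of_int (int q * z k + (\<Sum>i=1..m. c i * A i $ k))"
      using repr[OF v(1)] by blast
    \<comment> \<open>For \<open>k\<close> in \<open>M\<close> the left side of \<open>cz\<close> is
      zero, so the combination of rows equals \<open>- q * z k\<close> there.\<close>
    have M: "int q dvd (\<Sum>i=1..m. c i * A i $ k)" if "k \<in> M" for k
    proof -
      have "of_int (int q * z k + (\<Sum>i=1..m. c i * A i $ k)) = (0::rat)"
        using cz[of k] v(2) that by simp
      then have "int q * z k + (\<Sum>i=1..m. c i * A i $ k) = 0" by (simp only: of_int_eq_0_iff)
      then have "int q dvd int q * z k + (\<Sum>i=1..m. c i * A i $ k)" by simp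
      then show ?thesis by (subst (asm) dvd_add_right_iff) auto
    qed
    have all: "int q dvd (\<Sum>i=1..m. c i * A i $ k)" for k
    proof -
      have dvd: "\<forall>j\<in>{1..s}. [(\<Sum>i=1..m. c i * A i $ k) = 0] (mod int (p j))"
      proof
        fix j assume j: "j \<in> {1..s}"
        then obtain S where S: "S \<in> column_bases_mod (p j) m A" "S \<subseteq> M" using assms(8) by blast
        have "p j dvd q" unfolding assms(4) by (rule dvd_prodI[OF _ j]) simp
        then have pq: "int (p j) dvd int q" by (simp only: of_nat_dvd_iff)
        have pS: "int (p j) dvd (\<Sum>i=1..m. c i * A i $ l)" if "l \<in> S" for l
          using dvd_trans[OF pq M] S(2) that by blast
        have "prime (p j)" using assms(5) j by blast
        from column_basis_dvd[OF this S(1) pS] show "[(\<Sum>i=1..m. c i * A i $ k) = 0] (mod int (p j))" by (simp only: cong_0_iff)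
      qed
      \<comment> \<open>The strict decrease of the primes makes them distinct, so divisibility by
        each of them combines to divisibility by their product \<open>q\<close>.\<close>
      have coprime: "\<forall>i\<in>{1..s}. \<forall>j\<in>{1..s}. i \<noteq> j \<longrightarrow> coprime (int (p i)) (int (p j))"
      proof (intro ballI impI)
        fix i j assume ij: "i \<in> {1..s}" "j \<in> {1..s}" "i \<noteq> j"
        then have "i < j \<or> j < i" by (simp only: nat_neq_iff)
        then have "p j < p i \<or> p i < p j" using assms(6) ij(1,2) by blast
        then have "p i \<noteq> p j" by (simp only: nat_neq_iff disj_commute)
        then show "coprime (int (p i)) (int (p j))"
          using assms(5) ij(1,2) by (simp add: primes_coprime)
      qed
      have "[(\<Sum>i=1..m. c i * A i $ k) = 0] (mod (\<Prod>j=1..s. int (p j)))"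
        using dvd coprime by (rule cong_cong_prod_coprime)
      then show ?thesis using assms(4) by (simp add: cong_0_iff)
    qed
    have "v $ k \<in> \<int>" for k
    proof -
      obtain y where "(\<Sum>i=1..m. c i * A i $ k) = int q * y" using all[of k] by (auto elim: dvdE)
      then have "of_nat q * v $ k = of_nat q * of_int (z k + y)"
        using cz[of k] by (simp add: distrib_left)
      then have "v $ k = of_int (z k + y)" using q by simp
      then show ?thesis by (metis Ints_of_int)
    qed
    then show ?thesis by (simp add: integer_vectors_def)
  qed
  define F where "F = (\<lambda>k. axis k 1 :: rat ^ 'n) ` (- M)"
  have "{v \<in> \<Lambda>. \<forall>k\<in>M. v $ k = 0} = {v. v \<in> integer_vectors \<and> (\<forall>k. k \<notin> - M \<longrightarrow> v $ k = 0)}"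
    using prim Z by auto
  then have "is_lattice_basis F {v \<in> \<Lambda>. \<forall>k\<in>M. v $ k = 0}"
    unfolding F_def using unit_vectors_lattice_basis[of "- M"] by simp
  then obtain G where G: "G \<subseteq> \<Lambda>" "finite G" "card G = card M" "F \<inter> G = {}" "is_lattice_basis (F \<union> G) \<Lambda>"
    using lattice_basis_extend[OF sub Z q qL] by blast
  \<comment> \<open>Injectivity ensures that \<open>F\<close> has one vector for each index outside
    \<open>M\<close>.\<close>
  have "inj_on (\<lambda>k. axis k 1 :: rat ^ 'n) (- M)"
    by (auto simp: inj_on_def axis_eq_axis)
  then have "card F = CARD('n) - card M"
    unfolding F_def by (simp add: card_image Compl_eq_Diff_UNIV card_Diff_subset)
  moreover have "F \<subseteq> cart_basis" by (auto simp: F_def cart_basis_def)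
  moreover have "finite F" by (simp add: F_def)
  moreover have "card M \<le> CARD('n)" by (simp add: card_mono)
  \<comment> \<open>The number \<open>card M\<close> is admissible in the minimum that defines
    \<open>defect\<close>, with \<open>F\<close> and \<open>G\<close> as the two parts of the
    basis.\<close>
  ultimately show ?thesis
    unfolding defect_def using G by (intro Least_le conjI exI[of _ F] exI[of _ G])
qed

end
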